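(* Let $R$ be a commutative ring with $1\neq 0$ and let $S\subseteq R$ be a multiplicative set. The following are equivalent. (1) $S$ is strongly multiplicative. (2) For every family of ideals $(I_\lambda)_{\lambda\in\Lambda}$ of $R$, $\bigl(\bigcap_{\lambda\in\Lambda} I_\lambda\bigr)_S=\bigcap_{\lambda\in\Lambda}(I_\lambda)_S$ inside $R_S$. (3) There exists an idempotent $e\in R$ such that $R_S\cong Re$ as rings. (4) There exists an idempotent $e\in R$ such that $D(S)=D(e)$. Equivalently, $D(S)$ is clopen in $\operatorname{Spec}(R)$. Moreover, if $t$ is a least element of $S$ and $t=ue$ with $u\in R$ a unit and $e\in R$ an idempotent satisfying $tR=eR$ (such $u,e$ exist when $S$ is strongly multiplicative with least element $t$), then $R_S\cong R_t\cong R_e\cong Re$.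
   Context: A multiplicative set $S$ of $R$ is a subset with $0\notin S$, $1\in S$, and $st\in S$ for all $s,t\in S$. It is strongly multiplicative if $\bigl(\bigcap_{i\in\Delta}s_iR\bigr)\cap S\neq\varnothing$ for every family $(s_i)_{i\in\Delta}$ of elements of $S$. A least element of $S$ is an element $t\in S$ such that $s\mid t$ for every $s\in S$ (equivalently, $Rt\subseteq Rs$ for every $s\in S$). $R_S$ is the localization of $R$ at $S$, $I_S=IR_S$ for an ideal $I$ of $R$, and $R_t$, $R_e$ denote the localizations of $R$ at the powers of $t$, respectively $e$. For an idempotent $e$, $Re$ is regarded as a ring with identity $e$. $D(S)=\{\mathfrak p\in\operatorname{Spec}(R):\mathfrak p\cap S=\varnothing\}$ and $D(e)=\{\mathfrak p\in\operatorname{Spec}(R): e\notin\mathfrak p\}$; $\operatorname{Spec}(R)$ carries the Zariski topology.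
   Formalization: In (3), R_S ≅ Re is taken as a ring isomorphism compatible with the canonical maps from R; with a bare ring isomorphism (3)⇒(1) fails, e.g. R = k[x_i, y_j, 1/y_j : i,j ≥ 0], S = powers of x_0, e = 1. The isomorphisms in the "Moreover" part are likewise compatible with these maps. *)

theory Defs
  imports "HOL-Algebra.Algebra" "HOL-Analysis.Abstract_Topology"
begin

section \<open>Multiplicative sets\<close>

definition multiplicative_set :: "('a, 'b) ring_scheme \<Rightarrow> 'a set \<Rightarrow> bool" where
  "multiplicative_set R S \<longleftrightarrow>
     S \<subseteq> carrier R \<and> \<zero>\<^bsub>R\<^esub> \<notin> S \<and> \<one>\<^bsub>R\<^esub> \<in> S \<and> (\<forall>s\<in>S. \<forall>t\<in>S. s \<otimes>\<^bsub>R\<^esub> t \<in> S)"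

text \<open>
  An intersection of principal ideals depends only on the set of generators, so families in \<open>S\<close>
  are represented by subsets of \<open>S\<close>.  Intersecting with the carrier makes the empty intersection
  the whole ring.
\<close>

definition strongly_multiplicative :: "('a, 'b) ring_scheme \<Rightarrow> 'a set \<Rightarrow> bool" where
  "strongly_multiplicative R S \<longleftrightarrow> multiplicative_set R S \<and>
     (\<forall>T. T \<subseteq> S \<longrightarrow> (carrier R \<inter> (\<Inter>s\<in>T. PIdl\<^bsub>R\<^esub> s)) \<inter> S \<noteq> {})"

definition least_element :: "('a, 'b) ring_scheme \<Rightarrow> 'a set \<Rightarrow> 'a \<Rightarrow> bool" where
  "least_element R S t \<longleftrightarrow> t \<in> S \<and> (\<forall>s\<in>S. s divides\<^bsub>R\<^esub> t)"

definition powers :: "('a, 'b) ring_scheme \<Rightarrow> 'a \<Rightarrow> 'a set" where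
  "powers R t = {t [^]\<^bsub>R\<^esub> n | n :: nat. True}"

section \<open>Localization\<close>

definition frac_rel :: "('a, 'b) ring_scheme \<Rightarrow> 'a set \<Rightarrow> (('a \<times> 'a) \<times> ('a \<times> 'a)) set" where
  "frac_rel R S = {((r, s), (r', s')). r \<in> carrier R \<and> s \<in> S \<and> r' \<in> carrier R \<and> s' \<in> S \<and>
     (\<exists>u\<in>S. u \<otimes>\<^bsub>R\<^esub> ((s' \<otimes>\<^bsub>R\<^esub> r) \<ominus>\<^bsub>R\<^esub> (s \<otimes>\<^bsub>R\<^esub> r')) = \<zero>\<^bsub>R\<^esub>)}"

text \<open>The fraction \<open>r / s\<close>, as an equivalence class of pairs.\<close>

definition frac :: "('a, 'b) ring_scheme \<Rightarrow> 'a set \<Rightarrow> 'a \<Rightarrow> 'a \<Rightarrow> ('a \<times> 'a) set" where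
  "frac R S r s = frac_rel R S `` {(r, s)}"

definition localization :: "('a, 'b) ring_scheme \<Rightarrow> 'a set \<Rightarrow> ('a \<times> 'a) set ring" where
  "localization R S =
     \<lparr> carrier = (carrier R \<times> S) // frac_rel R S,
       monoid.mult = (\<lambda>F G. \<Union>(r, s)\<in>F. \<Union>(r', s')\<in>G. frac R S (r \<otimes>\<^bsub>R\<^esub> r') (s \<otimes>\<^bsub>R\<^esub> s')),
       one = frac R S \<one>\<^bsub>R\<^esub> \<one>\<^bsub>R\<^esub>,
       ring.zero = frac R S \<zero>\<^bsub>R\<^esub> \<one>\<^bsub>R\<^esub>,
       ring.add = (\<lambda>F G. \<Union>(r, s)\<in>F. \<Union>(r', s')\<in>G.
                frac R S ((s' \<otimes>\<^bsub>R\<^esub> r) \<oplus>\<^bsub>R\<^esub> (s \<otimes>\<^bsub>R\<^esub> r')) (s \<otimes>\<^bsub>R\<^esub> s')) \<rparr>"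

definition loc_map :: "('a, 'b) ring_scheme \<Rightarrow> 'a set \<Rightarrow> 'a \<Rightarrow> ('a \<times> 'a) set" where
  "loc_map R S r = frac R S r \<one>\<^bsub>R\<^esub>"

text \<open>The extended ideal \<open>I R\<^sub>S\<close>: the ideal generated by the image of \<open>I\<close>.\<close>

definition loc_ideal :: "('a, 'b) ring_scheme \<Rightarrow> 'a set \<Rightarrow> 'a set \<Rightarrow> ('a \<times> 'a) set set" where
  "loc_ideal R S I = Idl\<^bsub>localization R S\<^esub> (loc_map R S ` I)"

section \<open>Idempotents\<close>

definition idempotent_elem :: "('a, 'b) ring_scheme \<Rightarrow> 'a \<Rightarrow> bool" where
  "idempotent_elem R e \<longleftrightarrow> e \<in> carrier R \<and> e \<otimes>\<^bsub>R\<^esub> e = e"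

definition corner_ring :: "('a, 'b) ring_scheme \<Rightarrow> 'a \<Rightarrow> ('a, 'b) ring_scheme" where
  "corner_ring R e = R\<lparr> carrier := PIdl\<^bsub>R\<^esub> e, one := e \<rparr>"

definition corner_map :: "('a, 'b) ring_scheme \<Rightarrow> 'a \<Rightarrow> 'a \<Rightarrow> 'a" where
  "corner_map R e r = r \<otimes>\<^bsub>R\<^esub> e"

text \<open>
  Isomorphism of two rings \<open>A\<close>, \<open>B\<close> under \<open>R\<close>, that is, a ring isomorphism commuting with the
  canonical maps \<open>\<alpha> : R \<rightarrow> A\<close> and \<open>\<beta> : R \<rightarrow> B\<close>.  This is what an isomorphism between
  localizations of \<open>R\<close> and rings \<open>Re\<close> has to mean.  A mere ring isomorphism does not see how
  \<open>R\<close> maps to the two rings: for \<open>R = k[x\<^sub>0, x\<^sub>1, \<dots>, y\<^sub>0, y\<^sub>0\<inverse>, y\<^sub>1, y\<^sub>1\<inverse>, \<dots>]\<close> and \<open>S\<close> the powers of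
  \<open>x\<^sub>0\<close>, the ring \<open>R\<^sub>S\<close> is abstractly isomorphic to \<open>R = R1\<close>, yet \<open>S\<close> is not strongly
  multiplicative.
\<close>

definition iso_under ::
  "('a, 'b) ring_scheme \<Rightarrow> ('c, 'd) ring_scheme \<Rightarrow> ('a \<Rightarrow> 'c) \<Rightarrow> ('e, 'f) ring_scheme \<Rightarrow> ('a \<Rightarrow> 'e) \<Rightarrow> bool"
where
  "iso_under R A \<alpha> B \<beta> \<longleftrightarrow> (\<exists>\<phi>\<in>ring_iso A B. \<forall>r\<in>carrier R. \<phi> (\<alpha> r) = \<beta> r)"

section \<open>The prime spectrum\<close>

definition Spec :: "('a, 'b) ring_scheme \<Rightarrow> 'a set set" where
  "Spec R = {P. primeideal P R}"

definition zariski :: "('a, 'b) ring_scheme \<Rightarrow> 'a set topology" where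
  "zariski R = topology (\<lambda>U. \<exists>A. A \<subseteq> carrier R \<and> U = {P \<in> Spec R. \<not> A \<subseteq> P})"

lemma istopology_zariski:
  "istopology (\<lambda>U. \<exists>A. A \<subseteq> carrier R \<and> U = {P \<in> Spec R. \<not> A \<subseteq> P})"
  unfolding istopology_def
proof (intro conjI allI impI; (elim exE conjE)?)
  fix U V A B
  assume A: "A \<subseteq> carrier R" "U = {P \<in> Spec R. \<not> A \<subseteq> P}"
    and B: "B \<subseteq> carrier R" "V = {P \<in> Spec R. \<not> B \<subseteq> P}"
  let ?C = "{a \<otimes>\<^bsub>R\<^esub> b | a b. a \<in> A \<and> b \<in> B} \<inter> carrier R"
  have key: "\<not> ?C \<subseteq> P \<longleftrightarrow> \<not> A \<subseteq> P \<and> \<not> B \<subseteq> P" if "P \<in> Spec R" for P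
  proof -
    interpret primeideal P R
      using that by (simp add: Spec_def)
    show ?thesis
    proof
      assume "\<not> ?C \<subseteq> P"
      then obtain a b where "a \<in> A" "b \<in> B" "a \<otimes>\<^bsub>R\<^esub> b \<notin> P"
        by blast
      moreover from this have "a \<in> carrier R" "b \<in> carrier R"
        using A(1) B(1) by blast+
      ultimately have "a \<notin> P" "b \<notin> P"
        using I_l_closed[of b a] I_r_closed[of a b] by auto
      with \<open>a \<in> A\<close> \<open>b \<in> B\<close> show "\<not> A \<subseteq> P \<and> \<not> B \<subseteq> P"
        by blast
    next
      assume "\<not> A \<subseteq> P \<and> \<not> B \<subseteq> P"
      then obtain a b where ab: "a \<in> A" "a \<notin> P" "b \<in> B" "b \<notin> P"
        by blast
      then have car: "a \<in> carrier R" "b \<in> carrier R"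
        using A(1) B(1) by blast+
      then have "a \<otimes>\<^bsub>R\<^esub> b \<notin> P"
        using I_prime[of a b] ab(2,4) by blast
      moreover have "a \<otimes>\<^bsub>R\<^esub> b \<in> ?C"
        using ab(1,3) car by auto
      ultimately show "\<not> ?C \<subseteq> P"
        by blast
    qed
  qed
  have "U \<inter> V = {P \<in> Spec R. \<not> ?C \<subseteq> P}"
  proof (rule Set.set_eqI)
    fix P
    show "P \<in> U \<inter> V \<longleftrightarrow> P \<in> {P \<in> Spec R. \<not> ?C \<subseteq> P}"
      unfolding A(2) B(2) Int_iff mem_Collect_eq using key[of P] by argo
  qed
  then show "\<exists>C. C \<subseteq> carrier R \<and> U \<inter> V = {P \<in> Spec R. \<not> C \<subseteq> P}"
    by (intro exI[of _ ?C]) simp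
next
  fix K
  assume K: "\<forall>U\<in>K. \<exists>A. A \<subseteq> carrier R \<and> U = {P \<in> Spec R. \<not> A \<subseteq> P}"
  obtain A where A: "\<forall>U\<in>K. A U \<subseteq> carrier R \<and> U = {P \<in> Spec R. \<not> A U \<subseteq> P}"
    using bchoice[OF K] by (elim exE)
  have "P \<in> U \<longleftrightarrow> P \<in> Spec R \<and> \<not> A U \<subseteq> P" if "U \<in> K" for P U
  proof -
    have "U = {P \<in> Spec R. \<not> A U \<subseteq> P}"
      by (rule conjunct2[OF bspec[OF A that]])
    from eqset_imp_iff[OF this, of P] show ?thesis
      by simp
  qed
  then have "\<Union>K = {P \<in> Spec R. \<not> (\<Union>U\<in>K. A U) \<subseteq> P}"
    unfolding UN_subset_iff by blast
  moreover have "(\<Union>U\<in>K. A U) \<subseteq> carrier R"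
    using A by (simp add: UN_subset_iff)
  ultimately show "\<exists>A. A \<subseteq> carrier R \<and> \<Union>K = {P \<in> Spec R. \<not> A \<subseteq> P}"
    by (intro exI[of _ "\<Union>U\<in>K. A U"]) simp
qed

lemma openin_zariski:
  "openin (zariski R) U \<longleftrightarrow> (\<exists>A. A \<subseteq> carrier R \<and> U = {P \<in> Spec R. \<not> A \<subseteq> P})"
  unfolding zariski_def topology_inverse'[OF istopology_zariski] ..

definition D_set :: "('a, 'b) ring_scheme \<Rightarrow> 'a set \<Rightarrow> 'a set set" where
  "D_set R S = {P \<in> Spec R. P \<inter> S = {}}"

definition D_elem :: "('a, 'b) ring_scheme \<Rightarrow> 'a \<Rightarrow> 'a set set" where
  "D_elem R e = {P \<in> Spec R. e \<notin> P}"

end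

theory Submission
  imports Defs
begin

text \<open>
  The link between the conditions is a single idempotent: \<open>S\<close> is strongly multiplicative iff it has
  a least element \<open>t\<close>, and then \<open>t\<^sup>2\<close> divides \<open>t\<close>, say \<open>t = t\<^sup>2r\<close>, so \<open>e = tr\<close> is an idempotent
  that is divisible by every element of \<open>S\<close> and divides the element \<open>t\<close> of \<open>S\<close>.  Any idempotent
  with these two properties satisfies \<open>D(S) = D(e)\<close>, and inverting \<open>S\<close> then amounts to killing
  \<open>1 - e\<close>.  Conversely, an isomorphism under \<open>R\<close> between the localization and \<open>Re\<close>, or the
  equality \<open>D(S) = D(e)\<close>, forces both divisibility properties.  For a clopen \<open>D(S)\<close>, the idempotent
  comes from \<open>1 = a + b\<close> with \<open>ab\<close> nilpotent.
\<close>

section \<open>The ring of fractions and its extended ideals\<close>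

lemma (in cring) mem_cgenideal_iff_divides:
  assumes "a \<in> carrier R"
  shows "b \<in> PIdl a \<longleftrightarrow> a divides b"
  using assms m_comm unfolding cgenideal_def factor_def by blast

lemma (in cring) cgenideal_subset_carrier:
  assumes "a \<in> carrier R"
  shows "PIdl a \<subseteq> carrier R"
  using assms unfolding cgenideal_def by auto

text \<open>Zero is allowed in \<open>S\<close>, because the locale is also instantiated with the
  powers of an element that turns out to be nilpotent.\<close>

locale mult_subset = cring R for R (structure) +
  fixes S :: "'a set"
  assumes S_carrier: "S \<subseteq> carrier R"
    and one_in_S: "\<one> \<in> S"
    and mult_in_S: "s \<in> S \<Longrightarrow> t \<in> S \<Longrightarrow> s \<otimes> t \<in> S"
begin

lemma S_closed: "s \<in> S \<Longrightarrow> s \<in> carrier R"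
  using S_carrier by blast

text \<open>Moving the difference to two sides turns equality of fractions into an equation between
  products, which AC-rewriting can handle without signs.\<close>

lemma frac_rel_iff:
  "((r, s), (r', s')) \<in> frac_rel R S \<longleftrightarrow>
     r \<in> carrier R \<and> s \<in> S \<and> r' \<in> carrier R \<and> s' \<in> S \<and>
     (\<exists>u\<in>S. u \<otimes> (s' \<otimes> r) = u \<otimes> (s \<otimes> r'))"
proof -
  have "u \<otimes> ((s' \<otimes> r) \<ominus> (s \<otimes> r')) = \<zero> \<longleftrightarrow> u \<otimes> (s' \<otimes> r) = u \<otimes> (s \<otimes> r')"
    if "r \<in> carrier R" "s \<in> S" "r' \<in> carrier R" "s' \<in> S" "u \<in> S" for u
  proof -
    have c: "s \<in> carrier R" "s' \<in> carrier R" "u \<in> carrier R"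
      using that S_closed by auto
    have "u \<otimes> ((s' \<otimes> r) \<ominus> (s \<otimes> r')) = u \<otimes> (s' \<otimes> r) \<ominus> u \<otimes> (s \<otimes> r')"
      using that c by (simp add: minus_eq r_distr r_minus)
    then show ?thesis
      using that c r_right_minus_eq by simp
  qed
  then show ?thesis
    unfolding frac_rel_def by auto
qed

lemma equiv_frac_rel: "equiv (carrier R \<times> S) (frac_rel R S)"
proof (rule equivI)
  show "frac_rel R S \<subseteq> (carrier R \<times> S) \<times> (carrier R \<times> S)"
    by (auto simp: frac_rel_iff)
  show "refl_on (carrier R \<times> S) (frac_rel R S)"
    using one_in_S by (auto simp: refl_on_def frac_rel_iff)
  show "sym (frac_rel R S)"
    unfolding sym_def by (auto simp: frac_rel_iff) metis
  have "\<exists>w\<in>S. w \<otimes> (s3 \<otimes> r1) = w \<otimes> (s1 \<otimes> r3)"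
    if r: "r1 \<in> carrier R" "r2 \<in> carrier R" "r3 \<in> carrier R" and s: "s1 \<in> S" "s2 \<in> S" "s3 \<in> S"
      and u: "u \<in> S" "u \<otimes> (s2 \<otimes> r1) = u \<otimes> (s1 \<otimes> r2)"
      and v: "v \<in> S" "v \<otimes> (s3 \<otimes> r2) = v \<otimes> (s2 \<otimes> r3)"
    for r1 r2 r3 s1 s2 s3 u v
  proof
    \<comment> \<open>The middle denominator \<open>s2\<close> must join the two multipliers: it may
      be a zero divisor, so it cannot be cancelled from the combined equation.\<close>
    show "u \<otimes> v \<otimes> s2 \<in> S"
      using s u v mult_in_S by blast
    have c: "u \<in> carrier R" "v \<in> carrier R" "s1 \<in> carrier R" "s2 \<in> carrier R" "s3 \<in> carrier R"
      using s u v S_closed by auto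
    have "u \<otimes> v \<otimes> s2 \<otimes> (s3 \<otimes> r1) = v \<otimes> s3 \<otimes> (u \<otimes> (s2 \<otimes> r1))"
      using c r by (simp add: m_ac)
    also have "\<dots> = u \<otimes> s1 \<otimes> (v \<otimes> (s3 \<otimes> r2))"
      unfolding u(2) using c r by (simp add: m_ac)
    also have "\<dots> = u \<otimes> v \<otimes> s2 \<otimes> (s1 \<otimes> r3)"
      unfolding v(2) using c r by (simp add: m_ac)
    finally show "u \<otimes> v \<otimes> s2 \<otimes> (s3 \<otimes> r1) = u \<otimes> v \<otimes> s2 \<otimes> (s1 \<otimes> r3)" .
  qed
  then show "trans (frac_rel R S)"
    unfolding trans_def by (auto simp: frac_rel_iff)
qed

section \<open>Arithmetic of fractions\<close>

lemma frac_eq_iff: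
  assumes "r \<in> carrier R" "s \<in> S" "r' \<in> carrier R" "s' \<in> S"
  shows "frac R S r s = frac R S r' s' \<longleftrightarrow> (\<exists>u\<in>S. u \<otimes> (s' \<otimes> r) = u \<otimes> (s \<otimes> r'))"
  unfolding frac_def
  using eq_equiv_class_iff[OF equiv_frac_rel, of "(r, s)" "(r', s')"] assms frac_rel_iff by auto

lemma frac_eqI:
  assumes "r \<in> carrier R" "s \<in> S" "r' \<in> carrier R" "s' \<in> S" "s' \<otimes> r = s \<otimes> r'"
  shows "frac R S r s = frac R S r' s'"
  using assms one_in_S frac_eq_iff by metis

lemma mem_frac_iff:
  assumes "r \<in> carrier R" "s \<in> S"
  shows "(r', s') \<in> frac R S r s \<longleftrightarrow> r' \<in> carrier R \<and> s' \<in> S \<and> frac R S r' s' = frac R S r s"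
proof -
  have "(r', s') \<in> frac R S r s \<longleftrightarrow> ((r, s), (r', s')) \<in> frac_rel R S"
    by (simp add: frac_def)
  also have "\<dots> \<longleftrightarrow> r' \<in> carrier R \<and> s' \<in> S \<and> frac R S r s = frac R S r' s'"
    using assms frac_eq_iff frac_rel_iff by metis
  finally show ?thesis
    by auto
qed

lemma frac_closed:
  assumes "r \<in> carrier R" "s \<in> S"
  shows "frac R S r s \<in> carrier (localization R S)"
  using assms unfolding localization_def frac_def by (auto intro: quotientI)

lemma carrier_localizationE:
  assumes "x \<in> carrier (localization R S)"
  obtains r s where "r \<in> carrier R" "s \<in> S" "x = frac R S r s"
  using assms unfolding localization_def frac_def by (auto elim: quotientE)

text \<open>The operations of \<open>localization\<close> are unions over all representatives. Such
  a union collapses to a single value once the value does not depend on the representatives, so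
  well-definedness becomes a statement about pairs only.\<close>

lemma UN_frac_eq:
  assumes "r \<in> carrier R" "s \<in> S" "r' \<in> carrier R" "s' \<in> S"
    and "\<And>a b a' b'. a \<in> carrier R \<Longrightarrow> b \<in> S \<Longrightarrow> a' \<in> carrier R \<Longrightarrow> b' \<in> S \<Longrightarrow>
      frac R S a b = frac R S r s \<Longrightarrow> frac R S a' b' = frac R S r' s' \<Longrightarrow> h a b a' b' = c"
  shows "(\<Union>(a, b)\<in>frac R S r s. \<Union>(a', b')\<in>frac R S r' s'. h a b a' b') = c"
proof -
  have "h a b a' b' = c" if "(a, b) \<in> frac R S r s" "(a', b') \<in> frac R S r' s'" for a b a' b'
    using that assms mem_frac_iff by auto
  moreover have "(r, s) \<in> frac R S r s" "(r', s') \<in> frac R S r' s'"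
    using assms mem_frac_iff by auto
  ultimately show ?thesis
    by fast
qed

lemma mult_frac:
  assumes "r \<in> carrier R" "s \<in> S" "r' \<in> carrier R" "s' \<in> S"
  shows "frac R S r s \<otimes>\<^bsub>localization R S\<^esub> frac R S r' s' = frac R S (r \<otimes> r') (s \<otimes> s')"
proof -
  have "frac R S (a \<otimes> a') (b \<otimes> b') = frac R S (r \<otimes> r') (s \<otimes> s')"
    if a: "a \<in> carrier R" "b \<in> S" "a' \<in> carrier R" "b' \<in> S"
      and eq: "frac R S a b = frac R S r s" "frac R S a' b' = frac R S r' s'"
    for a b a' b'
  proof -
    obtain u where u: "u \<in> S" "u \<otimes> (s \<otimes> a) = u \<otimes> (b \<otimes> r)"
      using eq(1) a assms frac_eq_iff by auto
    obtain v where v: "v \<in> S" "v \<otimes> (s' \<otimes> a') = v \<otimes> (b' \<otimes> r')"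
      using eq(2) a assms frac_eq_iff by auto
    have c: "u \<in> carrier R" "v \<in> carrier R" "s \<in> carrier R" "s' \<in> carrier R"
        "b \<in> carrier R" "b' \<in> carrier R"
      using a assms u v S_closed by auto
    have "u \<otimes> v \<otimes> (s \<otimes> s' \<otimes> (a \<otimes> a')) = u \<otimes> (s \<otimes> a) \<otimes> (v \<otimes> (s' \<otimes> a'))"
      using c a by (simp add: m_ac)
    also have "\<dots> = u \<otimes> v \<otimes> (b \<otimes> b' \<otimes> (r \<otimes> r'))"
      unfolding u(2) v(2) using c assms by (simp add: m_ac)
    finally show ?thesis
      using a assms u v mult_in_S frac_eq_iff by auto
  qed
  from UN_frac_eq[OF assms this] show ?thesis
    by (simp add: localization_def)
qed

lemma add_frac:
  assumes "r \<in> carrier R" "s \<in> S" "r' \<in> carrier R" "s' \<in> S"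
  shows "frac R S r s \<oplus>\<^bsub>localization R S\<^esub> frac R S r' s' =
    frac R S (s' \<otimes> r \<oplus> s \<otimes> r') (s \<otimes> s')"
proof -
  have "frac R S (b' \<otimes> a \<oplus> b \<otimes> a') (b \<otimes> b') = frac R S (s' \<otimes> r \<oplus> s \<otimes> r') (s \<otimes> s')"
    if a: "a \<in> carrier R" "b \<in> S" "a' \<in> carrier R" "b' \<in> S"
      and eq: "frac R S a b = frac R S r s" "frac R S a' b' = frac R S r' s'"
    for a b a' b'
  proof -
    obtain u where u: "u \<in> S" "u \<otimes> (s \<otimes> a) = u \<otimes> (b \<otimes> r)"
      using eq(1) a assms frac_eq_iff by auto
    obtain v where v: "v \<in> S" "v \<otimes> (s' \<otimes> a') = v \<otimes> (b' \<otimes> r')"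
      using eq(2) a assms frac_eq_iff by auto
    have c: "u \<in> carrier R" "v \<in> carrier R" "s \<in> carrier R" "s' \<in> carrier R"
        "b \<in> carrier R" "b' \<in> carrier R"
      using a assms u v S_closed by auto
    \<comment> \<open>Each summand is arranged to contain the left-hand side of one of the two
      witness equations; the other factors are only carried along.\<close>
    have "u \<otimes> v \<otimes> (s \<otimes> s' \<otimes> (b' \<otimes> a \<oplus> b \<otimes> a')) =
        v \<otimes> s' \<otimes> b' \<otimes> (u \<otimes> (s \<otimes> a)) \<oplus> u \<otimes> s \<otimes> b \<otimes> (v \<otimes> (s' \<otimes> a'))"
      using c a by (simp add: m_ac r_distr)
    also have "\<dots> = u \<otimes> v \<otimes> (b \<otimes> b' \<otimes> (s' \<otimes> r \<oplus> s \<otimes> r'))"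
      unfolding u(2) v(2) using c assms by (simp add: m_ac r_distr)
    finally show ?thesis
      using a assms c u v mult_in_S frac_eq_iff by auto
  qed
  from UN_frac_eq[OF assms this] show ?thesis
    by (simp add: localization_def)
qed

lemma one_localization: "\<one>\<^bsub>localization R S\<^esub> = frac R S \<one> \<one>"
  and zero_localization: "\<zero>\<^bsub>localization R S\<^esub> = frac R S \<zero> \<one>"
  by (simp_all add: localization_def)

lemmas localization_simps = mult_frac add_frac one_localization zero_localization

lemma add_frac_minus:
  assumes "r \<in> carrier R" "s \<in> S"
  shows "frac R S (\<ominus> r) s \<oplus>\<^bsub>localization R S\<^esub> frac R S r s = \<zero>\<^bsub>localization R S\<^esub>"
proof -
  have "frac R S (s \<otimes> \<ominus> r \<oplus> s \<otimes> r) (s \<otimes> s) = frac R S \<zero> \<one>"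
    using assms by (intro frac_eqI) (simp_all add: one_in_S mult_in_S S_closed r_minus l_neg)
  with assms show ?thesis
    by (simp add: add_frac zero_localization)
qed

lemma cring_localization: "cring (localization R S)"
proof (rule cringI)
  let ?L = "localization R S"
  show "abelian_group ?L"
  proof (rule abelian_groupI)
    show "x \<oplus>\<^bsub>?L\<^esub> y \<in> carrier ?L" if "x \<in> carrier ?L" "y \<in> carrier ?L" for x y
      using that by (auto elim!: carrier_localizationE
          simp: add_frac frac_closed mult_in_S S_closed)
    show "\<zero>\<^bsub>?L\<^esub> \<in> carrier ?L"
      by (simp add: zero_localization frac_closed one_in_S)
    show "x \<oplus>\<^bsub>?L\<^esub> y \<oplus>\<^bsub>?L\<^esub> z = x \<oplus>\<^bsub>?L\<^esub> (y \<oplus>\<^bsub>?L\<^esub> z)"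
      if "x \<in> carrier ?L" "y \<in> carrier ?L" "z \<in> carrier ?L" for x y z
      using that by (auto elim!: carrier_localizationE intro!: frac_eqI
          simp: add_frac mult_in_S S_closed r_distr m_ac a_ac)
    show "x \<oplus>\<^bsub>?L\<^esub> y = y \<oplus>\<^bsub>?L\<^esub> x" if "x \<in> carrier ?L" "y \<in> carrier ?L" for x y
      using that by (auto elim!: carrier_localizationE intro!: frac_eqI
          simp: add_frac mult_in_S S_closed r_distr m_ac a_ac)
    show "\<zero>\<^bsub>?L\<^esub> \<oplus>\<^bsub>?L\<^esub> x = x" if "x \<in> carrier ?L" for x
      using that by (auto elim!: carrier_localizationE intro!: frac_eqI
          simp: zero_localization add_frac one_in_S S_closed)
    show "\<exists>y\<in>carrier ?L. y \<oplus>\<^bsub>?L\<^esub> x = \<zero>\<^bsub>?L\<^esub>" if "x \<in> carrier ?L" for x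
    proof -
      from that obtain r s where x: "r \<in> carrier R" "s \<in> S" "x = frac R S r s"
        by (rule carrier_localizationE)
      then have "frac R S (\<ominus> r) s \<oplus>\<^bsub>?L\<^esub> x = \<zero>\<^bsub>?L\<^esub>"
        by (simp add: add_frac_minus)
      with x show ?thesis
        using frac_closed by blast
    qed
  qed
  show "comm_monoid ?L"
  proof (rule comm_monoidI)
    show "x \<otimes>\<^bsub>?L\<^esub> y \<in> carrier ?L" if "x \<in> carrier ?L" "y \<in> carrier ?L" for x y
      using that by (auto elim!: carrier_localizationE simp: mult_frac frac_closed mult_in_S)
    show "\<one>\<^bsub>?L\<^esub> \<in> carrier ?L"
      by (simp add: one_localization frac_closed one_in_S)
    show "x \<otimes>\<^bsub>?L\<^esub> y \<otimes>\<^bsub>?L\<^esub> z = x \<otimes>\<^bsub>?L\<^esub> (y \<otimes>\<^bsub>?L\<^esub> z)"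
      if "x \<in> carrier ?L" "y \<in> carrier ?L" "z \<in> carrier ?L" for x y z
      using that by (auto elim!: carrier_localizationE
          simp: mult_frac mult_in_S S_closed m_assoc)
    show "\<one>\<^bsub>?L\<^esub> \<otimes>\<^bsub>?L\<^esub> x = x" if "x \<in> carrier ?L" for x
      using that by (auto elim!: carrier_localizationE
          simp: one_localization mult_frac one_in_S S_closed)
    show "x \<otimes>\<^bsub>?L\<^esub> y = y \<otimes>\<^bsub>?L\<^esub> x" if "x \<in> carrier ?L" "y \<in> carrier ?L" for x y
      using that by (auto elim!: carrier_localizationE
          simp: mult_frac S_closed m_comm)
  qed
  show "(x \<oplus>\<^bsub>?L\<^esub> y) \<otimes>\<^bsub>?L\<^esub> z = x \<otimes>\<^bsub>?L\<^esub> z \<oplus>\<^bsub>?L\<^esub> y \<otimes>\<^bsub>?L\<^esub> z"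
    if "x \<in> carrier ?L" "y \<in> carrier ?L" "z \<in> carrier ?L" for x y z
  proof -
    from that obtain r s r' s' q t where q: "r \<in> carrier R" "s \<in> S" "r' \<in> carrier R" "s' \<in> S"
        "q \<in> carrier R" "t \<in> S"
      and xyz: "x = frac R S r s" "y = frac R S r' s'" "z = frac R S q t"
      by (metis carrier_localizationE)
    have "frac R S ((s' \<otimes> r \<oplus> s \<otimes> r') \<otimes> q) (s \<otimes> s' \<otimes> t) =
        frac R S (s' \<otimes> t \<otimes> (r \<otimes> q) \<oplus> s \<otimes> t \<otimes> (r' \<otimes> q)) (s \<otimes> t \<otimes> (s' \<otimes> t))"
      using q by (intro frac_eqI) (simp_all add: mult_in_S S_closed l_distr r_distr m_ac)
    with q show ?thesis
      unfolding xyz by (simp add: mult_frac add_frac mult_in_S S_closed)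
  qed
qed

section \<open>The canonical map and extended ideals\<close>

lemma loc_map_closed: "r \<in> carrier R \<Longrightarrow> loc_map R S r \<in> carrier (localization R S)"
  by (simp add: loc_map_def frac_closed one_in_S)

lemma loc_map_hom: "loc_map R S \<in> ring_hom R (localization R S)"
  by (rule ring_hom_memI)
    (auto simp: loc_map_closed, auto simp: loc_map_def localization_simps one_in_S)

text \<open>Fractions with numerator in \<open>I\<close> are already closed under the ideal
  operations, since passing to a common denominator only multiplies numerators by ring elements.
  Conversely \<open>a/s\<close> is the product of \<open>a/1\<close> and \<open>1/s\<close>.\<close>

lemma loc_ideal_eq:
  assumes "ideal I R"
  shows "loc_ideal R S I = {frac R S a s | a s. a \<in> I \<and> s \<in> S}"
proof
  interpret I: ideal I R by fact
  interpret L: cring "localization R S" by (rule cring_localization)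
  let ?J = "{frac R S a s | a s. a \<in> I \<and> s \<in> S}"
  have sub: "loc_map R S ` I \<subseteq> carrier (localization R S)"
    using I.Icarr loc_map_closed by blast
  have "ideal ?J (localization R S)"
  proof (rule idealI)
    show "ring (localization R S)"
      by (rule L.ring_axioms)
    show "subgroup ?J (add_monoid (localization R S))"
    proof (rule L.add.subgroupI)
      show "?J \<subseteq> carrier (localization R S)"
        using I.Icarr frac_closed by blast
      show "?J \<noteq> {}"
        using I.zero_closed one_in_S by blast
      show "\<ominus>\<^bsub>localization R S\<^esub> x \<in> ?J" if x: "x \<in> ?J" for x
      proof -
        obtain a s where a: "a \<in> I" "s \<in> S" "x = frac R S a s"
          using x by blast
        then have "frac R S (\<ominus> a) s \<oplus>\<^bsub>localization R S\<^esub> x = \<zero>\<^bsub>localization R S\<^esub>"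
          by (simp add: add_frac_minus I.Icarr)
        then have "\<ominus>\<^bsub>localization R S\<^esub> x = frac R S (\<ominus> a) s"
          using a by (simp add: L.minus_equality I.Icarr frac_closed)
        then show ?thesis
          using a I.a_inv_closed by blast
      qed
      show "x \<oplus>\<^bsub>localization R S\<^esub> y \<in> ?J" if xy: "x \<in> ?J" "y \<in> ?J" for x y
      proof -
        obtain a s b t where a: "a \<in> I" "s \<in> S" "x = frac R S a s" "b \<in> I" "t \<in> S" "y = frac R S b t"
          using xy by blast
        then have "x \<oplus>\<^bsub>localization R S\<^esub> y = frac R S (t \<otimes> a \<oplus> s \<otimes> b) (s \<otimes> t)"
          by (simp add: add_frac I.Icarr)
        moreover have "t \<otimes> a \<oplus> s \<otimes> b \<in> I" "s \<otimes> t \<in> S"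
          using a S_closed I.I_l_closed I.a_closed mult_in_S by auto
        ultimately show ?thesis
          by blast
      qed
    qed
    show mult: "x \<otimes>\<^bsub>localization R S\<^esub> y \<in> ?J"
      if y: "y \<in> carrier (localization R S)" and x: "x \<in> ?J" for x y
    proof -
      obtain a s where a: "a \<in> I" "s \<in> S" "x = frac R S a s"
        using x by blast
      obtain b t where b: "b \<in> carrier R" "t \<in> S" "y = frac R S b t"
        using y by (rule carrier_localizationE)
      have "x \<otimes>\<^bsub>localization R S\<^esub> y = frac R S (a \<otimes> b) (s \<otimes> t)"
        using a b by (simp add: mult_frac I.Icarr)
      moreover have "a \<otimes> b \<in> I" "s \<otimes> t \<in> S"
        using a b I.I_r_closed mult_in_S by auto
      ultimately show ?thesis
        by blast
    qed
    show "y \<otimes>\<^bsub>localization R S\<^esub> x \<in> ?J"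
      if y: "y \<in> carrier (localization R S)" and x: "x \<in> ?J" for x y
    proof -
      have "x \<in> carrier (localization R S)"
        using x I.Icarr frac_closed by blast
      with mult[OF y x] y show ?thesis
        by (simp add: L.m_comm)
    qed
  qed
  moreover have "loc_map R S ` I \<subseteq> ?J"
    using one_in_S unfolding loc_map_def by blast
  ultimately show "loc_ideal R S I \<subseteq> ?J"
    unfolding loc_ideal_def by (rule L.genideal_minimal)
  interpret J: ideal "loc_ideal R S I" "localization R S"
    unfolding loc_ideal_def using sub by (rule L.genideal_ideal)
  show "?J \<subseteq> loc_ideal R S I"
  proof
    fix x assume "x \<in> ?J"
    then obtain a s where a: "a \<in> I" "s \<in> S" "x = frac R S a s"
      by blast
    have "loc_map R S a \<in> loc_ideal R S I"
      unfolding loc_ideal_def using a(1) L.genideal_self[OF sub] by blast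
    then have "loc_map R S a \<otimes>\<^bsub>localization R S\<^esub> frac R S \<one> s \<in> loc_ideal R S I"
      using a by (simp add: J.I_r_closed frac_closed)
    then show "x \<in> loc_ideal R S I"
      using a by (simp add: loc_map_def mult_frac one_in_S S_closed I.Icarr)
  qed
qed

text \<open>A fraction in the extended ideal may be written with a numerator outside
  \<open>I\<close>; clearing denominators shows that some multiple of this numerator by an element
  of \<open>S\<close> lies in \<open>I\<close>. This moves questions about extended ideals back to
  \<open>R\<close>.\<close>

lemma frac_in_loc_ideal_iff:
  assumes "ideal I R" "r \<in> carrier R" "s \<in> S"
  shows "frac R S r s \<in> loc_ideal R S I \<longleftrightarrow> (\<exists>u\<in>S. u \<otimes> r \<in> I)"
proof
  interpret I: ideal I R by fact
  assume "frac R S r s \<in> loc_ideal R S I"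
  then obtain a s' where a: "a \<in> I" "s' \<in> S" "frac R S r s = frac R S a s'"
    using loc_ideal_eq[OF assms(1)] by auto
  then obtain v where v: "v \<in> S" "v \<otimes> (s' \<otimes> r) = v \<otimes> (s \<otimes> a)"
    using assms I.Icarr frac_eq_iff by auto
  have "v \<otimes> s' \<otimes> r = v \<otimes> (s \<otimes> a)"
    using v a assms S_closed by (simp add: m_assoc)
  moreover have "v \<otimes> (s \<otimes> a) \<in> I"
    using v a assms S_closed I.I_l_closed by simp
  ultimately show "\<exists>u\<in>S. u \<otimes> r \<in> I"
    using v a mult_in_S by metis
next
  assume "\<exists>u\<in>S. u \<otimes> r \<in> I"
  then obtain u where u: "u \<in> S" "u \<otimes> r \<in> I"
    by blast
  have "frac R S r s = frac R S (u \<otimes> r) (u \<otimes> s)"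
    using u assms S_closed mult_in_S by (intro frac_eqI) (simp_all add: m_ac)
  then show "frac R S r s \<in> loc_ideal R S I"
    using u assms mult_in_S loc_ideal_eq[OF assms(1)] by blast
qed

text \<open>By Zorn's lemma there is an ideal maximal among those containing \<open>I\<close> and
  missing \<open>S\<close>, and such an ideal is prime. This is the only source of prime ideals
  below; it is applied to \<open>S\<close>, to \<open>{\<one>}\<close> and to the powers of an
  element.\<close>

lemma exists_prime_disjoint:
  assumes "ideal I R" "I \<inter> S = {}"
  obtains P where "primeideal P R" "I \<subseteq> P" "P \<inter> S = {}"
proof -
  let ?A = "{J. ideal J R \<and> I \<subseteq> J \<and> J \<inter> S = {}}"
  have "\<exists>M\<in>?A. \<forall>K\<in>?A. M \<subseteq> K \<longrightarrow> K = M"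
  proof (rule subset_Zorn)
    fix C assume C: "subset.chain ?A C"
    show "\<exists>U\<in>?A. \<forall>K\<in>C. K \<subseteq> U"
    \<comment> \<open>The union of the empty chain is not an ideal, so \<open>I\<close> itself
      serves as its upper bound.\<close>
    proof (cases "C = {}")
      case True
      then show ?thesis
        using assms by blast
    next
      case False
      have CA: "C \<subseteq> ?A"
        using C by (simp add: subset.chain_def)
      have "subset.chain {J. ideal J R} C"
        using C unfolding subset.chain_def by blast
      then have "ideal (\<Union>C) R"
        using chain_Union_is_ideal[of C] False by simp
      moreover have "I \<subseteq> \<Union>C" "\<Union>C \<inter> S = {}"
        using CA False by blast+
      ultimately show ?thesis
        by blast
    qed
  qed
  then obtain M where "M \<in> ?A" and maximal: "\<forall>K\<in>?A. M \<subseteq> K \<longrightarrow> K = M"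
    by (rule bexE)
  then have M: "ideal M R" "I \<subseteq> M" "M \<inter> S = {}"
    by simp_all
  have max: "K = M" if "ideal K R" "I \<subseteq> K" "K \<inter> S = {}" "M \<subseteq> K" for K
    using that maximal by simp
  interpret M: ideal M R by fact
  \<comment> \<open>Adjoining \<open>a\<close> to \<open>M\<close> gives a strictly larger ideal,
    which by maximality must meet \<open>S\<close>.\<close>
  have meets: "\<exists>m\<in>M. \<exists>x\<in>carrier R. m \<oplus> x \<otimes> a \<in> S" if a: "a \<in> carrier R" "a \<notin> M" for a
  proof (rule ccontr)
    assume contr: "\<not> ?thesis"
    let ?K = "M <+>\<^bsub>R\<^esub> PIdl a"
    have K_eq: "?K = {m \<oplus> x \<otimes> a | m x. m \<in> M \<and> x \<in> carrier R}"
      unfolding set_add_def' cgenideal_def by auto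
    have "ideal ?K R"
      using M(1) cgenideal_ideal[OF a(1)] by (rule add_ideals)
    moreover have "m \<in> ?K" if "m \<in> M" for m
      unfolding K_eq mem_Collect_eq using that a M.Icarr by (intro exI[of _ m] exI[of _ \<zero>]) simp
    moreover have "?K \<inter> S = {}"
      using contr unfolding K_eq by blast
    ultimately have "?K = M"
      using max[of ?K] M(2) by blast
    moreover have "a \<in> ?K"
      unfolding K_eq mem_Collect_eq using a M.zero_closed
      by (intro exI[of _ \<zero>] exI[of _ \<one>]) simp
    ultimately show False
      using a by simp
  qed
  have "primeideal M R"
  proof (rule primeidealI)
    show "ideal M R" "cring R"
      by unfold_locales
    show "carrier R \<noteq> M"
      using M(3) one_in_S by auto
    fix a b assume ab: "a \<in> carrier R" "b \<in> carrier R" "a \<otimes> b \<in> M"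
    show "a \<in> M \<or> b \<in> M"
    proof (rule ccontr)
      assume "\<not> ?thesis"
      then obtain m x n y where mn: "m \<in> M" "n \<in> M" "x \<in> carrier R" "y \<in> carrier R"
        and S: "m \<oplus> x \<otimes> a \<in> S" "n \<oplus> y \<otimes> b \<in> S"
        using meets ab by meson
      have c: "m \<in> carrier R" "n \<in> carrier R"
        using mn M.Icarr by auto
      \<comment> \<open>Every term of the expansion contains \<open>m\<close>, \<open>n\<close> or
        \<open>a \<otimes> b\<close>, all of them in \<open>M\<close>, although the product of the
        two factors lies in \<open>S\<close>.\<close>
      have "(m \<oplus> x \<otimes> a) \<otimes> (n \<oplus> y \<otimes> b) =
          m \<otimes> (n \<oplus> y \<otimes> b) \<oplus> (x \<otimes> a \<otimes> n \<oplus> x \<otimes> y \<otimes> (a \<otimes> b))"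
        using c mn ab by (simp add: l_distr r_distr m_ac a_ac)
      also have "\<dots> \<in> M"
        using c mn ab M.a_closed M.I_l_closed M.I_r_closed by simp
      finally show False
        using mult_in_S[OF S] M(3) by blast
    qed
  qed
  with M show ?thesis
    using that by blast
qed

end

section \<open>Clopen subsets of the spectrum\<close>

lemma (in cring) mult_subset_one: "mult_subset R {\<one>}"
  by unfold_locales auto

lemma (in cring) mult_subset_powers:
  assumes "a \<in> carrier R"
  shows "mult_subset R (powers R a)"
proof unfold_locales
  show "powers R a \<subseteq> carrier R"
    using assms by (auto simp: powers_def)
  show "\<one> \<in> powers R a"
    using assms by (auto simp: powers_def intro!: exI[of _ 0])
  show "s \<otimes> t \<in> powers R a" if "s \<in> powers R a" "t \<in> powers R a" for s t
    using that assms nat_pow_mult by (fastforce simp: powers_def)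
qed

text \<open>If no power of \<open>a\<close> were zero, the zero ideal would miss the powers of
  \<open>a\<close>, and some prime ideal would avoid \<open>a\<close>.\<close>

lemma (in cring) nilpotent_if_in_all_primes:
  assumes "a \<in> carrier R" "\<And>P. primeideal P R \<Longrightarrow> a \<in> P"
  obtains n :: nat where "a [^] n = \<zero>"
proof -
  interpret mult_subset R "powers R a"
    using assms(1) by (rule mult_subset_powers)
  have "{\<zero>} \<inter> powers R a \<noteq> {}"
  proof
    assume "{\<zero>} \<inter> powers R a = {}"
    then obtain P where P: "primeideal P R" "P \<inter> powers R a = {}"
      using exists_prime_disjoint zeroideal by metis
    have "a [^] (1 :: nat) \<in> powers R a"
      unfolding powers_def by blast
    then show False
      using assms P by auto
  qed
  then show ?thesis
    using that by (auto simp: powers_def)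
qed

text \<open>Multiplying the relation for the \<open>n\<close>-th power of \<open>b\<close> by the
  relation for \<open>b\<close> leaves exactly one term without a factor \<open>a\<close>, and that
  term contains the next power of \<open>b\<close>.\<close>

lemma (in cring) comaximal_power:
  assumes "a \<in> carrier R" "b \<in> carrier R"
    and "\<exists>p\<in>carrier R. \<exists>q\<in>carrier R. a \<otimes> p \<oplus> b \<otimes> q = \<one>"
  shows "\<exists>p\<in>carrier R. \<exists>q\<in>carrier R. a \<otimes> p \<oplus> b [^] (n :: nat) \<otimes> q = \<one>"
proof (induction n)
  case 0
  show ?case
    using assms by (intro bexI[of _ \<zero>] bexI[of _ \<one>]) auto
next
  case (Suc n)
  then obtain p q where p: "p \<in> carrier R" "q \<in> carrier R" "a \<otimes> p \<oplus> b [^] n \<otimes> q = \<one>"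
    by blast
  obtain p' q' where p': "p' \<in> carrier R" "q' \<in> carrier R" "a \<otimes> p' \<oplus> b \<otimes> q' = \<one>"
    using assms by blast
  have c: "b [^] n \<in> carrier R"
    using assms by simp
  have "\<one> = (a \<otimes> p \<oplus> b [^] n \<otimes> q) \<otimes> (a \<otimes> p' \<oplus> b \<otimes> q')"
    by (simp add: p p')
  also have "\<dots> = a \<otimes> (p \<otimes> (a \<otimes> p' \<oplus> b \<otimes> q') \<oplus> b [^] n \<otimes> q \<otimes> p') \<oplus> b [^] n \<otimes> b \<otimes> (q \<otimes> q')"
    using p(1,2) p'(1,2) c assms(1,2) by (simp add: l_distr r_distr m_ac a_ac)
  finally have "a \<otimes> (p \<otimes> (a \<otimes> p' \<oplus> b \<otimes> q') \<oplus> b [^] n \<otimes> q \<otimes> p') \<oplus> b [^] Suc n \<otimes> (q \<otimes> q') = \<one>"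
    by simp
  then show ?case
    using p(1,2) p'(1,2) c assms(1,2) by blast
qed

text \<open>Suitable multiples \<open>e\<close> and \<open>f\<close> of high powers of
  \<open>a\<close> and \<open>b\<close> still sum to 1, while their product is a multiple of
  \<open>(a \<otimes> b) [^] n\<close> and hence zero. Then \<open>e\<close> equals
  \<open>e \<otimes> (e \<oplus> f)\<close>, which is the square of \<open>e\<close>.\<close>

lemma (in cring) idempotent_from_nilpotent_product:
  assumes ab: "a \<in> carrier R" "b \<in> carrier R" "a \<oplus> b = \<one>"
    and n: "(a \<otimes> b) [^] (n :: nat) = \<zero>"
  obtains c d where "c \<in> carrier R" "d \<in> carrier R" "a \<otimes> c \<oplus> b \<otimes> d = \<one>"
    "idempotent_elem R (a \<otimes> c)"
proof -
  have "\<exists>p\<in>carrier R. \<exists>q\<in>carrier R. a \<otimes> p \<oplus> b \<otimes> q = \<one>"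
    using ab by (intro bexI[of _ \<one>]) auto
  \<comment> \<open>The power of \<open>b\<close> is raised first; after swapping the summands the
    same lemma raises the power of \<open>a\<close>. The exponent \<open>Suc n\<close> leaves one
    factor \<open>a\<close> in \<open>e\<close> and one factor \<open>b\<close> in \<open>f\<close>
    to split off, beyond the \<open>n\<close> factors of each that make the product vanish.\<close>
  then have "\<exists>p\<in>carrier R. \<exists>q\<in>carrier R. a \<otimes> p \<oplus> b [^] Suc n \<otimes> q = \<one>"
    using ab by (intro comaximal_power)
  then have "\<exists>q\<in>carrier R. \<exists>p\<in>carrier R. b [^] Suc n \<otimes> q \<oplus> a \<otimes> p = \<one>"
    using ab by (metis a_comm m_closed nat_pow_closed)
  then have "\<exists>q\<in>carrier R. \<exists>p\<in>carrier R. b [^] Suc n \<otimes> q \<oplus> a [^] Suc n \<otimes> p = \<one>"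
    using ab by (intro comaximal_power) auto
  then obtain p q where pq: "p \<in> carrier R" "q \<in> carrier R"
    "b [^] Suc n \<otimes> q \<oplus> a [^] Suc n \<otimes> p = \<one>"
    by blast
  define e f where "e = a [^] Suc n \<otimes> p" and "f = b [^] Suc n \<otimes> q"
  have ef: "e \<in> carrier R" "f \<in> carrier R" "e \<oplus> f = \<one>"
    using ab pq by (auto simp: e_def f_def a_comm)
  have "e \<otimes> f = (a [^] n \<otimes> b [^] n) \<otimes> (a \<otimes> b \<otimes> p \<otimes> q)"
    unfolding e_def f_def using ab pq(1,2) by (simp add: m_ac)
  also have "\<dots> = \<zero>"
    using ab pq(1,2) n nat_pow_distrib[of a b n] by simp
  finally have "e \<otimes> f = \<zero>" .
  then have "e \<otimes> e = e \<otimes> (e \<oplus> f)"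
    using ef(1,2) by (simp add: r_distr)
  then have "idempotent_elem R e"
    using ef unfolding idempotent_elem_def by simp
  moreover have "e = a \<otimes> (a [^] n \<otimes> p)" "f = b \<otimes> (b [^] n \<otimes> q)"
    unfolding e_def f_def using ab pq(1,2) by (simp_all add: m_ac)
  ultimately show ?thesis
    using that[of "a [^] n \<otimes> p" "b [^] n \<otimes> q"] ef ab pq by simp
qed

section \<open>Clopen sets and idempotents\<close>

lemma openin_zariski_subset: "openin (zariski R) U \<Longrightarrow> U \<subseteq> Spec R"
  by (auto simp: openin_zariski)

lemma (in cring) topspace_zariski: "topspace (zariski R) = Spec R"
proof
  show "topspace (zariski R) \<subseteq> Spec R"
    using openin_zariski_subset openin_topspace by blast
  have "\<one> \<notin> P" if "primeideal P R" for P
    using that ideal.one_imp_carrier[of P R] primeideal.I_notcarr primeideal.axioms(1) by metis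
  then have "Spec R = {P \<in> Spec R. \<not> {\<one>} \<subseteq> P}"
    by (auto simp: Spec_def)
  then have "openin (zariski R) (Spec R)"
    unfolding openin_zariski by (intro exI[of _ "{\<one>}"]) simp
  then show "Spec R \<subseteq> topspace (zariski R)"
    by (rule openin_subset)
qed

text \<open>A prime ideal cannot contain both elements, whose sum is 1, and must contain one of
  them, as their product is zero.\<close>

lemma (in cring) D_elem_cover:
  assumes "e \<in> carrier R" "f \<in> carrier R" "e \<oplus> f = \<one>" "e \<otimes> f = \<zero>"
  shows "Spec R - D_elem R e = D_elem R f"
proof -
  have "e \<in> P \<longleftrightarrow> f \<notin> P" if "primeideal P R" for P
  proof -
    interpret P: primeideal P R by fact
    have "\<not> (e \<in> P \<and> f \<in> P)"
      using P.a_closed P.one_imp_carrier P.I_notcarr assms(3) by metis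
    moreover have "e \<in> P \<or> f \<in> P"
      using assms P.I_prime P.zero_closed by simp
    ultimately show ?thesis
      by blast
  qed
  then show ?thesis
    by (auto simp: D_elem_def Spec_def)
qed

lemma openin_D_elem: "e \<in> carrier R \<Longrightarrow> openin (zariski R) (D_elem R e)"
  unfolding openin_zariski D_elem_def by (intro exI[of _ "{e}"]) simp

lemma (in cring) clopen_D_elem:
  assumes "idempotent_elem R e"
  shows "openin (zariski R) (D_elem R e)" "closedin (zariski R) (D_elem R e)"
proof -
  have e: "e \<in> carrier R" "e \<otimes> e = e"
    using assms by (auto simp: idempotent_elem_def)
  then have f: "\<one> \<ominus> e \<in> carrier R" "e \<oplus> (\<one> \<ominus> e) = \<one>" "e \<otimes> (\<one> \<ominus> e) = \<zero>"
    by (simp_all add: minus_eq r_distr r_minus r_neg a_lcomm[of e])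
  then have "Spec R - D_elem R e = D_elem R (\<one> \<ominus> e)"
    using e by (intro D_elem_cover)
  moreover have "D_elem R e \<subseteq> Spec R"
    by (auto simp: D_elem_def)
  ultimately show "closedin (zariski R) (D_elem R e)"
    using openin_D_elem[OF f(1)] by (simp add: closedin_def topspace_zariski)
  show "openin (zariski R) (D_elem R e)"
    using e(1) by (rule openin_D_elem)
qed

text \<open>Let \<open>A\<close> and \<open>B\<close> define \<open>U\<close> and its complement. No
  prime contains both generated ideals, so these are comaximal and 1 splits as
  \<open>a \<oplus> b\<close>. Every prime contains one of the two ideals, so
  \<open>a \<otimes> b\<close> lies in all primes and is nilpotent.\<close>

lemma (in cring) clopen_imp_D_elem:
  assumes "openin (zariski R) U" "closedin (zariski R) U"
  obtains e where "idempotent_elem R e" "U = D_elem R e"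
proof -
  obtain A where A: "A \<subseteq> carrier R" "U = {P \<in> Spec R. \<not> A \<subseteq> P}"
    using assms(1) by (auto simp: openin_zariski)
  have "openin (zariski R) (Spec R - U)"
    using assms(2) by (simp add: closedin_def topspace_zariski)
  then obtain B where B: "B \<subseteq> carrier R" "Spec R - U = {P \<in> Spec R. \<not> B \<subseteq> P}"
    by (auto simp: openin_zariski)
  have sub: "H \<subseteq> P \<longleftrightarrow> Idl H \<subseteq> P" if "primeideal P R" "H \<subseteq> carrier R" for H P
    using that Idl_subset_ideal primeideal.axioms(1) by blast
  have either: "Idl A \<subseteq> P \<longleftrightarrow> \<not> Idl B \<subseteq> P" if "primeideal P R" for P
  proof -
    have "P \<in> Spec R"
      using that by (simp add: Spec_def)
    then have "A \<subseteq> P \<longleftrightarrow> \<not> B \<subseteq> P"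
      using A(2) B(2) by blast
    then show ?thesis
      using that A(1) B(1) sub by blast
  qed
  interpret I: ideal "Idl A" R
    using A(1) by (rule genideal_ideal)
  interpret J: ideal "Idl B" R
    using B(1) by (rule genideal_ideal)
  have "\<one> \<in> Idl A <+>\<^bsub>R\<^esub> Idl B"
  proof (rule ccontr)
    assume "\<one> \<notin> Idl A <+>\<^bsub>R\<^esub> Idl B"
    then have "(Idl A <+>\<^bsub>R\<^esub> Idl B) \<inter> {\<one>} = {}"
      by simp
    then obtain P where P: "primeideal P R" "Idl A <+>\<^bsub>R\<^esub> Idl B \<subseteq> P"
      by (rule mult_subset.exists_prime_disjoint
          [OF mult_subset_one add_ideals[OF I.is_ideal J.is_ideal]])
    have add: "x \<oplus> y \<in> P" if "x \<in> Idl A" "y \<in> Idl B" for x y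
      using that P(2) unfolding set_add_def' by blast
    have "x \<in> P" if "x \<in> Idl A" for x
      using add[OF that J.zero_closed] that I.Icarr by simp
    moreover have "x \<in> P" if "x \<in> Idl B" for x
      using add[OF I.zero_closed that] that J.Icarr by simp
    ultimately have "Idl A \<subseteq> P" "Idl B \<subseteq> P"
      by blast+
    with either[OF P(1)] show False
      by blast
  qed
  then obtain a b where ab: "a \<in> Idl A" "b \<in> Idl B" "a \<oplus> b = \<one>"
    unfolding set_add_def' by auto
  have c: "a \<in> carrier R" "b \<in> carrier R"
    using ab I.Icarr J.Icarr by auto
  have "a \<otimes> b \<in> P" if "primeideal P R" for P
  proof -
    interpret P: primeideal P R by fact
    have "a \<in> P \<or> b \<in> P"
      using either[OF that] ab by blast
    then show ?thesis
      using c P.I_l_closed P.I_r_closed by blast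
  qed
  then obtain n :: nat where "(a \<otimes> b) [^] n = \<zero>"
    using c nilpotent_if_in_all_primes[of "a \<otimes> b"] by auto
  then obtain p q where pq: "p \<in> carrier R" "q \<in> carrier R" "a \<otimes> p \<oplus> b \<otimes> q = \<one>"
    and e: "idempotent_elem R (a \<otimes> p)"
    using c ab(3) idempotent_from_nilpotent_product by blast
  \<comment> \<open>If \<open>P\<close> contains \<open>a \<otimes> p\<close> but not
    \<open>Idl A\<close>, then it contains \<open>Idl B\<close>, hence \<open>b \<otimes> q\<close>,
    and therefore 1.\<close>
  have "Idl A \<subseteq> P \<longleftrightarrow> a \<otimes> p \<in> P" if "primeideal P R" for P
  proof
    interpret P: primeideal P R by fact
    show "a \<otimes> p \<in> P" if "Idl A \<subseteq> P"
      using that ab pq P.I_r_closed by blast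
    show "Idl A \<subseteq> P" if "a \<otimes> p \<in> P"
    proof (rule ccontr)
      assume "\<not> Idl A \<subseteq> P"
      then have "b \<otimes> q \<in> P"
        using either[OF \<open>primeideal P R\<close>] ab pq P.I_r_closed by blast
      with that show False
        using pq(3) P.a_closed P.one_imp_carrier P.I_notcarr by metis
    qed
  qed
  then have "U = D_elem R (a \<otimes> p)"
    unfolding A(2) D_elem_def Spec_def using sub A(1) by blast
  with e show ?thesis
    using that by blast
qed

section \<open>Idempotents attached to a multiplicative set\<close>

lemma multiplicative_set_imp_mult_subset:
  assumes "cring R" "multiplicative_set R S"
  shows "mult_subset R S"
  using assms by (auto simp: multiplicative_set_def mult_subset_def mult_subset_axioms_def)

section \<open>From least elements to idempotents\<close>

context mult_subset
begin

text \<open>The family of all elements of \<open>S\<close> is the decisive one: an element of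
  \<open>S\<close> in the intersection of all its principal ideals is a least element, and it then
  lies in the intersection for every subfamily.\<close>

lemma strongly_multiplicative_iff_least_element:
  assumes "\<zero> \<notin> S"
  shows "strongly_multiplicative R S \<longleftrightarrow> (\<exists>t. least_element R S t)"
proof
  assume "strongly_multiplicative R S"
  then have "(carrier R \<inter> (\<Inter>s\<in>S. PIdl s)) \<inter> S \<noteq> {}"
    by (simp add: strongly_multiplicative_def)
  then obtain t where "t \<in> S" "\<And>s. s \<in> S \<Longrightarrow> t \<in> PIdl s"
    by blast
  then show "\<exists>t. least_element R S t"
    unfolding least_element_def by (metis mem_cgenideal_iff_divides S_closed)
next
  assume "\<exists>t. least_element R S t"
  then obtain t where "t \<in> S" "\<And>s. s \<in> S \<Longrightarrow> t \<in> PIdl s"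
    unfolding least_element_def by (metis mem_cgenideal_iff_divides S_closed)
  then show "strongly_multiplicative R S"
    unfolding strongly_multiplicative_def multiplicative_set_def
    using assms S_carrier one_in_S mult_in_S by blast
qed

text \<open>The two divisibility conditions say that the divisors of elements of \<open>S\<close>
  are exactly the divisors of \<open>e\<close>, that is, \<open>S\<close> and
  \<open>{\<one>, e}\<close> have the same saturation.\<close>

definition cut_out_by :: "'a \<Rightarrow> bool" where
  "cut_out_by e \<longleftrightarrow> idempotent_elem R e \<and> (\<forall>s\<in>S. s divides e) \<and> (\<exists>t\<in>S. e divides t)"

lemma cut_out_by_closed: "cut_out_by e \<Longrightarrow> e \<in> carrier R"
  by (simp add: cut_out_by_def idempotent_elem_def)

text \<open>A multiple of an idempotent is fixed by it. Such a \<open>t\<close> annihilates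
  \<open>1 - e\<close>, so it is the multiplier that witnesses \<open>e/1 = 1\<close> in the
  localization.\<close>

lemma cut_out_by_absorb:
  assumes "cut_out_by e"
  obtains t where "t \<in> S" "t \<otimes> e = t"
proof -
  obtain t c where t: "t \<in> S" "c \<in> carrier R" "t = e \<otimes> c"
    using assms by (auto simp: cut_out_by_def factor_def)
  then have "t \<otimes> e = (e \<otimes> e) \<otimes> c"
    using cut_out_by_closed[OF assms] by (simp add: m_ac)
  also have "\<dots> = t"
    using assms t by (simp add: cut_out_by_def idempotent_elem_def)
  finally show ?thesis
    using that t by blast
qed

lemma least_element_factorization:
  assumes "least_element R S t"
  obtains u e where "u \<in> Units R" "idempotent_elem R e" "t = u \<otimes> e" "PIdl t = PIdl e"
proof -
  have t: "t \<in> S" "t \<in> carrier R"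
    using assms S_closed by (auto simp: least_element_def)
  then have "t \<otimes> t divides t"
    using assms mult_in_S by (auto simp: least_element_def)
  then obtain r where r: "r \<in> carrier R" "t = t \<otimes> t \<otimes> r"
    by (auto simp: factor_def)
  define e where "e = t \<otimes> r"
  have e: "e \<in> carrier R" "t \<otimes> e = t"
    using t r by (simp_all add: e_def m_assoc[symmetric])
  have "e \<otimes> e = (t \<otimes> e) \<otimes> r"
    using t r(1) e(1) by (simp add: e_def m_ac)
  then have ee: "e \<otimes> e = e"
    unfolding e(2) by (simp add: e_def)
  define f where "f = \<one> \<ominus> e"
  have f: "f \<in> carrier R" "e \<oplus> f = \<one>"
    using e(1) by (simp_all add: f_def minus_eq a_lcomm[of e] r_neg)
  have f0: "e \<otimes> f = \<zero>" "t \<otimes> f = \<zero>"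
    using e t ee by (simp_all add: f_def minus_eq r_distr r_minus r_neg)
  have ff: "f \<otimes> f = f"
  proof -
    have "f \<otimes> f = (e \<oplus> f) \<otimes> f"
      using e(1) f(1) f0 by (simp add: l_distr)
    then show ?thesis
      using f by simp
  qed
  \<comment> \<open>The unit \<open>t \<oplus> f\<close> acts as \<open>t\<close> on
    \<open>Re\<close> and as the identity on \<open>Rf\<close>. Its inverse \<open>?v\<close> is
    glued in the same way, since \<open>r \<otimes> e\<close> inverts \<open>t\<close> on
    \<open>Re\<close>.\<close>
  let ?v = "r \<otimes> e \<oplus> f"
  have "(t \<oplus> f) \<otimes> ?v = (t \<otimes> e) \<otimes> r \<oplus> r \<otimes> (e \<otimes> f) \<oplus> (t \<otimes> f) \<oplus> f \<otimes> f"
    using t(2) r(1) e(1) f(1) by (simp add: l_distr r_distr m_ac a_ac)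
  also have "\<dots> = \<one>"
    using f f0 ff e r(1) t(2) by (simp add: e_def[symmetric])
  finally have "(t \<oplus> f) \<otimes> ?v = \<one>" .
  moreover from this have "?v \<otimes> (t \<oplus> f) = \<one>"
    using t(2) r(1) e(1) f(1) m_comm[of ?v "t \<oplus> f"] by simp
  ultimately have "t \<oplus> f \<in> Units R"
    using t(2) r(1) e(1) f(1) unfolding Units_def by auto
  moreover have "idempotent_elem R e"
    using e ee by (simp add: idempotent_elem_def)
  moreover have "t = (t \<oplus> f) \<otimes> e"
    using t(2) e f f0 by (simp add: l_distr m_comm[of f e])
  moreover have "PIdl t = PIdl e"
  proof
    show "PIdl t \<subseteq> PIdl e"
      using e t cgenideal_ideal mem_cgenideal_iff_divides
      by (metis cgenideal_minimal divides_prod_r dividesI m_comm)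
    show "PIdl e \<subseteq> PIdl t"
      using e t r mem_cgenideal_iff_divides
      by (metis cgenideal_ideal cgenideal_minimal dividesI e_def)
  qed
  ultimately show ?thesis
    using that by blast
qed

lemma cut_out_by_least_element:
  assumes "least_element R S t" "idempotent_elem R e" "PIdl t = PIdl e"
  shows "cut_out_by e"
proof -
  have c: "t \<in> S" "t \<in> carrier R" "e \<in> carrier R"
    using assms S_closed by (auto simp: least_element_def idempotent_elem_def)
  then have te: "t divides e" "e divides t"
    using assms(3) mem_cgenideal_iff_divides cgenideal_self by blast+
  moreover have "s divides e" if "s \<in> S" for s
    using that assms(1) te c S_closed divides_trans[of s t e] by (auto simp: least_element_def)
  ultimately show ?thesis
    using assms(2) c by (auto simp: cut_out_by_def)
qed

lemma strongly_multiplicative_iff_cut_out: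
  assumes "\<zero> \<notin> S"
  shows "strongly_multiplicative R S \<longleftrightarrow> (\<exists>e. cut_out_by e)"
proof
  assume "strongly_multiplicative R S"
  then obtain t where t: "least_element R S t"
    using assms strongly_multiplicative_iff_least_element by blast
  then show "\<exists>e. cut_out_by e"
    using least_element_factorization cut_out_by_least_element by metis
next
  assume "\<exists>e. cut_out_by e"
  then obtain e t where e: "cut_out_by e" and t: "t \<in> S" "e divides t"
    by (auto simp: cut_out_by_def)
  have "s divides t" if "s \<in> S" for s
    using that e t S_closed divides_trans[of s e t] by (auto simp: cut_out_by_def)
  then have "least_element R S t"
    using t by (simp add: least_element_def)
  then show "strongly_multiplicative R S"
    using assms strongly_multiplicative_iff_least_element by blast
qed

text \<open>Divisibility passes membership in a prime from divisor to multiple, which gives the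
  equality of the two sets. Conversely, a failing divisibility makes a principal ideal miss a
  multiplicative set, and a prime separating them lies in only one of the two sets.\<close>

lemma cut_out_by_iff_D_set:
  assumes "idempotent_elem R e"
  shows "cut_out_by e \<longleftrightarrow> D_set R S = D_elem R e"
proof
  assume e: "cut_out_by e"
  obtain t where t: "t \<in> S" "t \<otimes> e = t"
    using e by (rule cut_out_by_absorb)
  have "P \<inter> S = {} \<longleftrightarrow> e \<notin> P" if "primeideal P R" for P
  proof -
    interpret P: primeideal P R by fact
    have "e \<in> P" if s: "s \<in> P" "s \<in> S" for s
    proof -
      obtain c where "c \<in> carrier R" "e = s \<otimes> c"
        using e s by (auto simp: cut_out_by_def factor_def)
      then show ?thesis
        using s P.I_r_closed by simp
    qed
    moreover have "t \<in> P" if "e \<in> P"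
      using P.I_l_closed[OF that, of t] t S_closed by simp
    ultimately show ?thesis
      using t by blast
  qed
  then show "D_set R S = D_elem R e"
    unfolding D_set_def D_elem_def Spec_def by auto
next
  assume D: "D_set R S = D_elem R e"
  have c: "e \<in> carrier R" "e \<otimes> e = e"
    using assms by (auto simp: idempotent_elem_def)
  have iff: "P \<inter> S = {} \<longleftrightarrow> e \<notin> P" if "primeideal P R" for P
    using D that unfolding D_set_def D_elem_def Spec_def by auto
  have "\<exists>t\<in>S. e divides t"
  proof (rule ccontr)
    assume "\<not> (\<exists>t\<in>S. e divides t)"
    then have "PIdl e \<inter> S = {}"
      using c mem_cgenideal_iff_divides by blast
    then obtain P where "primeideal P R" "PIdl e \<subseteq> P" "P \<inter> S = {}"
      using exists_prime_disjoint cgenideal_ideal c by metis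
    then show False
      using iff cgenideal_self c by blast
  qed
  moreover have "s divides e" if "s \<in> S" for s
  proof (rule ccontr)
    assume n: "\<not> s divides e"
    have s: "s \<in> carrier R"
      using that S_closed by blast
    \<comment> \<open>The powers of \<open>e\<close> are only 1 and \<open>e\<close>, so
      \<open>PIdl s\<close> misses them as soon as \<open>s\<close> divides neither.\<close>
    have "\<not> s divides \<one>"
      using n s c by (metis divides_prod_r l_one one_closed)
    moreover have "powers R e \<subseteq> {\<one>, e}"
    proof -
      have "e [^] n \<in> {\<one>, e}" for n :: nat
        by (induction n) (use c in auto)
      then show ?thesis
        by (auto simp: powers_def)
    qed
    ultimately have "PIdl s \<inter> powers R e = {}"
      using n s mem_cgenideal_iff_divides by auto
    then obtain P where P: "primeideal P R" "PIdl s \<subseteq> P" "P \<inter> powers R e = {}"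
      using mult_subset.exists_prime_disjoint[OF mult_subset_powers] cgenideal_ideal s c by metis
    moreover have "e [^] (1 :: nat) \<in> powers R e"
      unfolding powers_def by blast
    ultimately have "e \<notin> P"
      using c by auto
    moreover have "s \<in> P"
      using P s cgenideal_self by blast
    ultimately show False
      using iff P that by blast
  qed
  ultimately show "cut_out_by e"
    using assms by (simp add: cut_out_by_def)
qed

text \<open>The canonical map is restricted to \<open>Re\<close>, so no representatives have to be
  chosen. Every \<open>u\<close> in \<open>S\<close> divides \<open>e\<close>, the identity of
  \<open>Re\<close>, so multiplication by \<open>u\<close> is injective there; and if
  \<open>e = s \<otimes> q\<close>, the fraction \<open>r/s\<close> is the image of
  \<open>r \<otimes> q \<otimes> e\<close>.\<close>

lemma loc_map_ring_iso_corner: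
  assumes "cut_out_by e"
  shows "loc_map R S \<in> ring_iso (corner_ring R e) (localization R S)"
proof -
  have e: "e \<in> carrier R" "e \<otimes> e = e"
    using assms by (auto simp: cut_out_by_def idempotent_elem_def)
  obtain t where t: "t \<in> S" "t \<otimes> e = t"
    using assms by (rule cut_out_by_absorb)
  have absorb: "x \<otimes> e = x" "x \<in> carrier R" if "x \<in> PIdl e" for x
    using that e by (auto simp: cgenideal_def m_assoc)
  have one: "loc_map R S e = \<one>\<^bsub>localization R S\<^esub>"
    using t e S_closed one_in_S frac_eq_iff[of e \<one> \<one> \<one>]
    by (auto simp: loc_map_def one_localization)
  have inj: "inj_on (loc_map R S) (PIdl e)"
  proof (rule inj_onI)
    fix x y assume xy: "x \<in> PIdl e" "y \<in> PIdl e" "loc_map R S x = loc_map R S y"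
    then obtain u where u: "u \<in> S" "u \<otimes> x = u \<otimes> y"
      using absorb frac_eq_iff[of x \<one> y \<one>] one_in_S by (auto simp: loc_map_def)
    obtain c where c: "c \<in> carrier R" "e = u \<otimes> c"
      using u assms by (auto simp: cut_out_by_def factor_def)
    have uc: "z = (u \<otimes> z) \<otimes> c" if "z \<in> PIdl e" for z
    proof -
      have "z = z \<otimes> (u \<otimes> c)"
        using absorb(1)[OF that] by (simp only: c(2)[symmetric])
      also have "\<dots> = (u \<otimes> z) \<otimes> c"
        using absorb(2)[OF that] u(1) c(1) S_closed by (simp add: m_ac)
      finally show ?thesis .
    qed
    show "x = y"
      using uc[OF xy(1)] uc[OF xy(2)] u(2) by simp
  qed
  have surj: "loc_map R S ` (PIdl e) = carrier (localization R S)"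
  proof
    show "loc_map R S ` (PIdl e) \<subseteq> carrier (localization R S)"
      using absorb loc_map_closed by blast
    show "carrier (localization R S) \<subseteq> loc_map R S ` (PIdl e)"
    proof
      fix x assume "x \<in> carrier (localization R S)"
      then obtain r s where rs: "r \<in> carrier R" "s \<in> S" "x = frac R S r s"
        by (rule carrier_localizationE)
      obtain q where q: "q \<in> carrier R" "e = s \<otimes> q"
        using rs assms by (auto simp: cut_out_by_def factor_def)
      have c: "s \<in> carrier R" "t \<in> carrier R"
        using rs t S_closed by auto
      \<comment> \<open>The absorbing \<open>t\<close> supplies two copies of \<open>e\<close>: one
        is replaced by \<open>s \<otimes> q\<close>, the other keeps the new numerator in
        \<open>Re\<close>.\<close>
      have "t \<otimes> (\<one> \<otimes> r) = (t \<otimes> e \<otimes> e) \<otimes> r"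
        using rs t c by simp
      also have "\<dots> = (t \<otimes> (s \<otimes> q) \<otimes> e) \<otimes> r"
        by (simp only: q(2)[symmetric])
      also have "\<dots> = t \<otimes> (s \<otimes> (r \<otimes> q \<otimes> e))"
        using rs(1) c q(1) e(1) by (simp add: m_ac)
      finally have "x = loc_map R S (r \<otimes> q \<otimes> e)"
        unfolding rs(3) loc_map_def using rs t q one_in_S e by (subst frac_eq_iff) auto
      moreover have "r \<otimes> q \<otimes> e \<in> PIdl e"
        using rs q by (auto simp: cgenideal_def)
      ultimately show "x \<in> loc_map R S ` (PIdl e)"
        by blast
    qed
  qed
  have "loc_map R S \<in> ring_hom (corner_ring R e) (localization R S)"
    by (rule ring_hom_memI)
      (auto simp: corner_ring_def absorb one loc_map_closed
        ring_hom_mult[OF loc_map_hom] ring_hom_add[OF loc_map_hom])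
  with inj surj show ?thesis
    by (simp add: ring_iso_def bij_betw_def corner_ring_def)
qed

text \<open>Because \<open>t \<otimes> e = t\<close>, the elements \<open>r\<close> and
  \<open>r \<otimes> e\<close> have the same image in the localization.\<close>

lemma iso_under_corner:
  assumes "cut_out_by e"
  shows "iso_under R (corner_ring R e) (corner_map R e) (localization R S) (loc_map R S)"
proof -
  have e: "e \<in> carrier R"
    using assms by (rule cut_out_by_closed)
  obtain t where t: "t \<in> S" "t \<otimes> e = t"
    using assms by (rule cut_out_by_absorb)
  have "loc_map R S (corner_map R e r) = loc_map R S r" if r: "r \<in> carrier R" for r
  proof -
    have c: "t \<in> carrier R"
      using t S_closed by blast
    have "t \<otimes> (r \<otimes> e) = (t \<otimes> e) \<otimes> r"
      using r e c by (simp add: m_ac)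
    then have "t \<otimes> (r \<otimes> e) = t \<otimes> r"
      unfolding t(2) .
    then have "\<exists>u\<in>S. u \<otimes> (\<one> \<otimes> (r \<otimes> e)) = u \<otimes> (\<one> \<otimes> r)"
      using t(1) r e by (intro bexI[of _ t]) simp_all
    then show ?thesis
      using r e one_in_S frac_eq_iff[of "r \<otimes> e" \<one> r \<one>]
      by (simp add: loc_map_def corner_map_def)
  qed
  then show ?thesis
    unfolding iso_under_def using loc_map_ring_iso_corner[OF assms] by (intro bexI) simp_all
qed

text \<open>Compatibility with the canonical maps enters twice. The elements \<open>e\<close> and 1
  agree in \<open>Re\<close>, hence in the localization, which yields \<open>u\<close> in
  \<open>S\<close> with \<open>u \<otimes> e = u\<close>. And \<open>s/1\<close> is invertible, so
  \<open>s \<otimes> e\<close> is invertible in \<open>Re\<close>, which makes \<open>s\<close> a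
  divisor of \<open>e\<close>.\<close>

lemma cut_out_by_if_iso_under:
  assumes e: "idempotent_elem R e"
    and iso: "iso_under R (localization R S) (loc_map R S) (corner_ring R e) (corner_map R e)"
  shows "cut_out_by e"
proof -
  have c: "e \<in> carrier R" "e \<otimes> e = e"
    using e by (auto simp: idempotent_elem_def)
  obtain \<phi> where \<phi>: "\<phi> \<in> ring_iso (localization R S) (corner_ring R e)"
    and comm: "\<And>r. r \<in> carrier R \<Longrightarrow> \<phi> (loc_map R S r) = r \<otimes> e"
    using iso by (auto simp: iso_under_def corner_map_def)
  have one: "\<phi> \<one>\<^bsub>localization R S\<^esub> = e"
    using ring_iso_memE(4)[OF \<phi>] by (simp add: corner_ring_def)
  have "\<exists>t\<in>S. e divides t"
  proof -
    have "\<phi> (loc_map R S e) = \<phi> (loc_map R S \<one>)"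
      using c by (simp add: comm)
    then have "loc_map R S e = loc_map R S \<one>"
      using ring_iso_memE(5)[OF \<phi>] c loc_map_closed by (auto simp: bij_betw_def inj_on_def)
    then obtain u where u: "u \<in> S" "u \<otimes> e = u"
      using c one_in_S S_closed frac_eq_iff[of e \<one> \<one> \<one>] by (auto simp: loc_map_def)
    then have "e divides u"
      using c S_closed by (metis dividesI m_comm)
    with u show ?thesis
      by blast
  qed
  moreover have "s divides e" if s: "s \<in> S" for s
  proof -
    have sc: "s \<in> carrier R"
      using s S_closed by blast
    define y where "y = \<phi> (frac R S \<one> s)"
    have "y \<in> PIdl e"
      using ring_iso_memE(1)[OF \<phi> frac_closed] s by (simp add: y_def corner_ring_def)
    then have y: "y \<in> carrier R"
      using c cgenideal_subset_carrier by blast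
    have "loc_map R S s \<otimes>\<^bsub>localization R S\<^esub> frac R S \<one> s = \<one>\<^bsub>localization R S\<^esub>"
      using s sc one_in_S frac_eqI[of s s \<one> \<one>]
      by (simp add: loc_map_def mult_frac one_localization)
    then have "e = (s \<otimes> e) \<otimes> y"
      using ring_iso_memE(2)[OF \<phi>, of "loc_map R S s" "frac R S \<one> s"] s sc
      by (simp add: loc_map_closed frac_closed comm one y_def corner_ring_def)
    also have "\<dots> = s \<otimes> (e \<otimes> y)"
      using sc c y by (simp add: m_assoc)
    finally show ?thesis
      using c y unfolding factor_def by blast
  qed
  ultimately show ?thesis
    using e by (simp add: cut_out_by_def)
qed

end

section \<open>Extension of ideals and intersections\<close>

text \<open>Membership of \<open>r/s\<close> in an extended ideal asks for a multiplier that depends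
  on the ideal. A least element \<open>t\<close> serves as multiplier for all ideals at once, so the
  condition commutes with intersections.\<close>

lemma (in mult_subset) strongly_multiplicative_iff_loc_ideal_Inter:
  assumes "\<zero> \<notin> S"
  shows "strongly_multiplicative R S \<longleftrightarrow>
    (\<forall>\<I>. (\<forall>I\<in>\<I>. ideal I R) \<longrightarrow>
      loc_ideal R S (carrier R \<inter> (\<Inter>I\<in>\<I>. I)) =
      carrier (localization R S) \<inter> (\<Inter>I\<in>\<I>. loc_ideal R S I))"
    (is "_ \<longleftrightarrow> (\<forall>\<I>. _ \<longrightarrow> ?commutes \<I>)")
proof
  \<comment> \<open>Adjoining the whole ring as a member covers the empty family.\<close>
  have ideal_Inter: "ideal (carrier R \<inter> \<Inter>\<I>) R" if "\<forall>I\<in>\<I>. ideal I R" for \<I>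
    using that i_Intersect[of "insert (carrier R) \<I>"] oneideal by auto
  {
    assume "strongly_multiplicative R S"
    then obtain t where t: "t \<in> S" "\<And>s. s \<in> S \<Longrightarrow> s divides t"
      using assms strongly_multiplicative_iff_least_element by (auto simp: least_element_def)
    show "\<forall>\<I>. (\<forall>I\<in>\<I>. ideal I R) \<longrightarrow> ?commutes \<I>"
    proof (intro allI impI Set.set_eqI)
      fix \<I> x assume \<I>: "\<forall>I\<in>\<I>. ideal I R"
      have key: "(\<exists>u\<in>S. u \<otimes> r \<in> I) \<longleftrightarrow> t \<otimes> r \<in> I" if I: "ideal I R" and r: "r \<in> carrier R" for I r
      proof
        interpret I: ideal I R by fact
        assume "\<exists>u\<in>S. u \<otimes> r \<in> I"
        then obtain u where u: "u \<in> S" "u \<otimes> r \<in> I"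
          by blast
        obtain c where c: "c \<in> carrier R" "t = u \<otimes> c"
          using t(2)[OF u(1)] by (auto simp: factor_def)
        have "t \<otimes> r = c \<otimes> (u \<otimes> r)"
          unfolding c(2) using c(1) u r S_closed by (simp add: m_ac)
        then show "t \<otimes> r \<in> I"
          using c u I.I_l_closed by simp
      next
        assume "t \<otimes> r \<in> I"
        then show "\<exists>u\<in>S. u \<otimes> r \<in> I"
          using t by blast
      qed
      have sub: "loc_ideal R S J \<subseteq> carrier (localization R S)" if "ideal J R" for J
        using that loc_ideal_eq frac_closed ideal.Icarr[OF that] by auto
      show "x \<in> loc_ideal R S (carrier R \<inter> (\<Inter>I\<in>\<I>. I)) \<longleftrightarrow>
          x \<in> carrier (localization R S) \<inter> (\<Inter>I\<in>\<I>. loc_ideal R S I)"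
      proof (cases "x \<in> carrier (localization R S)")
        case True
        then obtain r s where rs: "r \<in> carrier R" "s \<in> S" "x = frac R S r s"
          by (rule carrier_localizationE)
        have mem: "x \<in> loc_ideal R S J \<longleftrightarrow> t \<otimes> r \<in> J" if "ideal J R" for J
          using that rs frac_in_loc_ideal_iff key by simp
        show ?thesis
          using True mem[OF ideal_Inter[OF \<I>]] mem \<I> rs t S_closed by auto
      next
        case False
        then show ?thesis
          using sub[OF ideal_Inter[OF \<I>]] by auto
      qed
    qed
  next
    assume comm: "\<forall>\<I>. (\<forall>I\<in>\<I>. ideal I R) \<longrightarrow> ?commutes \<I>"
    \<comment> \<open>Each of these ideals becomes the unit ideal in the localization. If extension
      commutes with their intersection, some \<open>u\<close> in \<open>S\<close> lies in all of
      them and is a least element.\<close>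
    define \<I> where "\<I> = (\<lambda>s. PIdl s) ` S"
    have \<I>: "\<forall>I\<in>\<I>. ideal I R"
      using S_closed cgenideal_ideal by (auto simp: \<I>_def)
    have "frac R S \<one> \<one> \<in> loc_ideal R S (PIdl s)" if s: "s \<in> S" for s
    proof -
      have "s \<otimes> \<one> \<in> PIdl s"
        using s S_closed cgenideal_self by simp
      then show ?thesis
        using s S_closed cgenideal_ideal one_in_S frac_in_loc_ideal_iff by blast
    qed
    then have "frac R S \<one> \<one> \<in> carrier (localization R S) \<inter> (\<Inter>I\<in>\<I>. loc_ideal R S I)"
      using frac_closed one_in_S by (auto simp: \<I>_def)
    then have "frac R S \<one> \<one> \<in> loc_ideal R S (carrier R \<inter> \<Inter>\<I>)"
      using comm \<I> by simp
    then obtain u where "u \<in> S" "u \<otimes> \<one> \<in> carrier R \<inter> \<Inter>\<I>"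
      using frac_in_loc_ideal_iff[OF ideal_Inter[OF \<I>]] one_in_S by auto
    then have "least_element R S u"
      using S_closed mem_cgenideal_iff_divides by (auto simp: least_element_def \<I>_def)
    then show "strongly_multiplicative R S"
      using assms strongly_multiplicative_iff_least_element by blast
  }
qed

section \<open>Isomorphisms of rings under a base ring\<close>

text \<open>On \<open>Re\<close> the element \<open>u \<otimes> e\<close> is a unit, with inverse
  \<open>inv u \<otimes> e\<close>, so each of its powers divides \<open>e\<close>. The case
  \<open>u = \<one>\<close> treats the powers of \<open>e\<close> itself.\<close>

lemma (in cring) powers_cut_out_by:
  assumes "idempotent_elem R e" "u \<in> Units R"
  shows "mult_subset.cut_out_by R (powers R (u \<otimes> e)) e"
proof -
  have c: "e \<in> carrier R" "e \<otimes> e = e" "u \<in> carrier R"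
    using assms by (auto simp: idempotent_elem_def)
  interpret P: mult_subset R "powers R (u \<otimes> e)"
    using c by (intro mult_subset_powers) simp
  have "(u \<otimes> e) [^] n divides e" for n :: nat
  proof -
    have "(u \<otimes> e) [^] n \<otimes> ((inv u) [^] n \<otimes> e) = e"
    proof (induction n)
      case (Suc n)
      have "(u \<otimes> e) [^] Suc n \<otimes> ((inv u) [^] Suc n \<otimes> e) =
          (u \<otimes> inv u) \<otimes> ((u \<otimes> e) [^] n \<otimes> ((inv u) [^] n \<otimes> e)) \<otimes> e"
        using c(1,3) assms(2) by (simp add: m_ac del: Units_r_inv Units_l_inv)
      with Suc show ?case
        using c assms(2) by simp
    qed (use c in simp)
    then show ?thesis
      using c assms(2) unfolding factor_def
      by (metis Units_inv_closed m_closed nat_pow_closed)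
  qed
  moreover have "u \<otimes> e \<in> powers R (u \<otimes> e)"
    unfolding powers_def using c by (auto intro!: exI[of _ 1])
  moreover have "e divides (u \<otimes> e)"
    using c by (metis dividesI m_comm)
  ultimately show ?thesis
    using assms(1) unfolding P.cut_out_by_def by (auto simp: powers_def)
qed

lemma iso_under_sym:
  assumes "ring A" "iso_under R A \<alpha> B \<beta>" "\<And>r. r \<in> carrier R \<Longrightarrow> \<alpha> r \<in> carrier A"
  shows "iso_under R B \<beta> A \<alpha>"
proof -
  obtain \<phi> where \<phi>: "\<phi> \<in> ring_iso A B" "\<And>r. r \<in> carrier R \<Longrightarrow> \<phi> (\<alpha> r) = \<beta> r"
    using assms(2) by (auto simp: iso_under_def)
  have "inv_into (carrier A) \<phi> (\<beta> r) = \<alpha> r" if "r \<in> carrier R" for r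
    using \<phi>(2)[OF that] assms(3)[OF that] ring_iso_memE(5)[OF \<phi>(1)]
    by (metis bij_betw_imp_inj_on inv_into_f_f)
  then show ?thesis
    using ring_iso_set_sym[OF assms(1) \<phi>(1)] unfolding iso_under_def by blast
qed

lemma iso_under_trans:
  assumes "iso_under R A \<alpha> B \<beta>" "iso_under R B \<beta> C \<gamma>"
  shows "iso_under R A \<alpha> C \<gamma>"
proof -
  obtain \<phi> \<psi> where "\<phi> \<in> ring_iso A B" "\<And>r. r \<in> carrier R \<Longrightarrow> \<phi> (\<alpha> r) = \<beta> r"
    and "\<psi> \<in> ring_iso B C" "\<And>r. r \<in> carrier R \<Longrightarrow> \<psi> (\<beta> r) = \<gamma> r"
    using assms unfolding iso_under_def by blast
  then show ?thesis
    unfolding iso_under_def using ring_iso_set_trans by (intro bexI[of _ "\<psi> \<circ> \<phi>"]) auto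
qed

text \<open>Reversing the isomorphism from \<open>Re\<close> to the localization requires its source
  to be a ring.\<close>

lemma (in cring) ring_corner_ring:
  assumes "idempotent_elem R e"
  shows "ring (corner_ring R e)"
proof -
  have e: "e \<in> carrier R" "e \<otimes> e = e"
    using assms by (auto simp: idempotent_elem_def)
  have I: "ideal (PIdl e) R"
    using e(1) by (rule cgenideal_ideal)
  have car: "x \<in> carrier R" if "x \<in> PIdl e" for x
    using I that by (rule ideal.Icarr)
  have absorb: "x \<otimes> e = x" "e \<otimes> x = x" if x: "x \<in> PIdl e" for x
  proof -
    obtain c where c: "c \<in> carrier R" "x = c \<otimes> e"
      using x unfolding cgenideal_def by blast
    show "x \<otimes> e = x"
      unfolding c(2) using c(1) e by (simp add: m_assoc)
    then show "e \<otimes> x = x"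
      using m_comm[OF e(1) car[OF x]] by simp
  qed
  interpret I: ideal "PIdl e" R
    by (rule I)
  have neg: "\<exists>y\<in>PIdl e. x \<oplus> y = \<zero>" if "x \<in> PIdl e" for x
    using I.a_inv_closed[OF that] r_neg[OF car[OF that]] by blast
  show ?thesis
  proof (rule ringI)
    show "abelian_group (corner_ring R e)"
      by (rule abelian_groupI)
        (auto simp: corner_ring_def car neg a_ac)
    show "monoid (corner_ring R e)"
      by (rule monoidI)
        (auto simp: corner_ring_def car I.I_l_closed absorb cgenideal_self e m_assoc)
  qed (auto simp: corner_ring_def car l_distr r_distr)
qed

lemma (in mult_subset) iso_under_localization_corner:
  assumes "cut_out_by e"
  shows "iso_under R (localization R S) (loc_map R S) (corner_ring R e) (corner_map R e)"
proof (rule iso_under_sym)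
  show "ring (corner_ring R e)"
    using assms ring_corner_ring by (simp add: cut_out_by_def)
  show "corner_map R e r \<in> carrier (corner_ring R e)" if "r \<in> carrier R" for r
    using that by (auto simp: corner_map_def corner_ring_def cgenideal_def)
qed (rule iso_under_corner[OF assms])

text \<open>The comparison goes through \<open>Re\<close>, to which both localizations are
  isomorphic under \<open>R\<close>.\<close>

lemma iso_under_localizations:
  assumes "mult_subset R S" "mult_subset R T"
    and "mult_subset.cut_out_by R S e" "mult_subset.cut_out_by R T e"
  shows "iso_under R (localization R S) (loc_map R S) (localization R T) (loc_map R T)"
  using mult_subset.iso_under_localization_corner[OF assms(1,3)]
    mult_subset.iso_under_corner[OF assms(2,4)]
  by (rule iso_under_trans)

theorem theorem2p6:
  fixes R :: "('a, 'b) ring_scheme" (structure) and S :: "'a set"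
  assumes "cring R" and "\<one> \<noteq> \<zero>" and "multiplicative_set R S"
  shows
    "(strongly_multiplicative R S \<longleftrightarrow>
       (\<forall>\<I>. (\<forall>I\<in>\<I>. ideal I R) \<longrightarrow>
          loc_ideal R S (carrier R \<inter> (\<Inter>I\<in>\<I>. I)) =
          carrier (localization R S) \<inter> (\<Inter>I\<in>\<I>. loc_ideal R S I)))
   \<and> (strongly_multiplicative R S \<longleftrightarrow>
       (\<exists>e. idempotent_elem R e \<and>
          iso_under R (localization R S) (loc_map R S) (corner_ring R e) (corner_map R e)))
   \<and> (strongly_multiplicative R S \<longleftrightarrow>
       (\<exists>e. idempotent_elem R e \<and> D_set R S = D_elem R e))
   \<and> ((\<exists>e. idempotent_elem R e \<and> D_set R S = D_elem R e) \<longleftrightarrow>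
       openin (zariski R) (D_set R S) \<and> closedin (zariski R) (D_set R S))
   \<and> (\<forall>t u e. least_element R S t \<and> u \<in> Units R \<and> idempotent_elem R e \<and> t = u \<otimes> e \<and>
          PIdl t = PIdl e \<longrightarrow>
        iso_under R (localization R S) (loc_map R S)
          (localization R (powers R t)) (loc_map R (powers R t)) \<and>
        iso_under R (localization R (powers R t)) (loc_map R (powers R t))
          (localization R (powers R e)) (loc_map R (powers R e)) \<and>
        iso_under R (localization R (powers R e)) (loc_map R (powers R e))
          (corner_ring R e) (corner_map R e))
   \<and> (\<forall>t. strongly_multiplicative R S \<and> least_element R S t \<longrightarrow>
        (\<exists>u e. u \<in> Units R \<and> idempotent_elem R e \<and> t = u \<otimes> e \<and> PIdl t = PIdl e))"
proof -
  interpret mult_subset R S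
    using assms(1,3) by (rule multiplicative_set_imp_mult_subset)
  have S0: "\<zero> \<notin> S"
    using assms(3) by (simp add: multiplicative_set_def)
  have idem: "idempotent_elem R e" if "cut_out_by e" for e
    using that by (simp add: cut_out_by_def)
  have "strongly_multiplicative R S \<longleftrightarrow> (\<exists>e. idempotent_elem R e \<and>
      iso_under R (localization R S) (loc_map R S) (corner_ring R e) (corner_map R e))"
    unfolding strongly_multiplicative_iff_cut_out[OF S0]
    using cut_out_by_if_iso_under iso_under_localization_corner idem by blast
  moreover have "strongly_multiplicative R S \<longleftrightarrow>
      (\<exists>e. idempotent_elem R e \<and> D_set R S = D_elem R e)"
    unfolding strongly_multiplicative_iff_cut_out[OF S0]
    using cut_out_by_iff_D_set idem by blast
  moreover have "(\<exists>e. idempotent_elem R e \<and> D_set R S = D_elem R e) \<longleftrightarrow>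
      openin (zariski R) (D_set R S) \<and> closedin (zariski R) (D_set R S)"
    using clopen_D_elem clopen_imp_D_elem by metis
  moreover have
    "\<forall>t u e. least_element R S t \<and> u \<in> Units R \<and> idempotent_elem R e \<and> t = u \<otimes> e \<and>
        PIdl t = PIdl e \<longrightarrow>
      iso_under R (localization R S) (loc_map R S)
        (localization R (powers R t)) (loc_map R (powers R t)) \<and>
      iso_under R (localization R (powers R t)) (loc_map R (powers R t))
        (localization R (powers R e)) (loc_map R (powers R e)) \<and>
      iso_under R (localization R (powers R e)) (loc_map R (powers R e))
        (corner_ring R e) (corner_map R e)"
  proof (intro allI impI, elim conjE)
    fix t u e
    assume t: "least_element R S t" and u: "u \<in> Units R" and e: "idempotent_elem R e"
      and tu: "t = u \<otimes> e" and eq: "PIdl t = PIdl e"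
    have c: "e \<in> carrier R" "t \<in> carrier R"
      using e u tu by (auto simp: idempotent_elem_def)
    \<comment> \<open>One idempotent cuts out all three multiplicative sets: \<open>S\<close>, the
      powers of \<open>t = u \<otimes> e\<close>, and the powers of \<open>e\<close>, where the unit
      is 1.\<close>
    have cut: "cut_out_by e" "mult_subset.cut_out_by R (powers R t) e"
        "mult_subset.cut_out_by R (powers R e) e"
      using cut_out_by_least_element[OF t e eq] powers_cut_out_by[OF e u]
        powers_cut_out_by[OF e Units_one_closed] tu c by simp_all
    have powers: "mult_subset R (powers R t)" "mult_subset R (powers R e)"
      using c by (simp_all add: mult_subset_powers)
    show "iso_under R (localization R S) (loc_map R S)
        (localization R (powers R t)) (loc_map R (powers R t)) \<and>
      iso_under R (localization R (powers R t)) (loc_map R (powers R t))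
        (localization R (powers R e)) (loc_map R (powers R e)) \<and>
      iso_under R (localization R (powers R e)) (loc_map R (powers R e))
        (corner_ring R e) (corner_map R e)"
      using iso_under_localizations[OF mult_subset_axioms powers(1) cut(1,2)]
        iso_under_localizations[OF powers cut(2,3)]
        mult_subset.iso_under_localization_corner[OF powers(2) cut(3)]
      by (intro conjI)
  qed
  moreover have "\<forall>t. strongly_multiplicative R S \<and> least_element R S t \<longrightarrow>
      (\<exists>u e. u \<in> Units R \<and> idempotent_elem R e \<and> t = u \<otimes> e \<and> PIdl t = PIdl e)"
    using least_element_factorization by metis
  ultimately show ?thesis
    using strongly_multiplicative_iff_loc_ideal_Inter[OF S0] by (intro conjI)
qed

end
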